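(* Let $X$ be a real Banach space with $\dim X\geqslant 2$. Then the following conditions are equivalent: (i) $X$ is a Hilbert space. (ii) $L_X(t)=2t^2-2t+1$ for every $t\in[0,\frac12)$. (iii) $L_X(t_0)=2t_0^2-2t_0+1$ for some $t_0\in[0,\frac12)$.
   Context: For $x,y$ in a real Banach space $X$, isosceles orthogonality $x\perp_I y$ means $\|x+y\|=\|x-y\|$. For $0\leqslant t<\frac12$ define $$L_X(t)=\sup\left\{\frac{\|tx+(1-t)y\|^2+\|(1-t)x+ty\|^2}{\|x+y\|^2}: x,y\in X,\ (x,y)\neq(0,0),\ x\perp_I y\right\}.$$ "$X$ is a Hilbert space" means that the norm of $X$ is induced by an inner product. *)

theory Defs
  imports "HOL-Analysis.Analysis"
begin

definition isosceles_orthogonal :: "'a::real_normed_vector \<Rightarrow> 'a \<Rightarrow> bool"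
    (infix "\<bottom>\<^sub>I" 50) where
  "x \<bottom>\<^sub>I y \<longleftrightarrow> norm (x + y) = norm (x - y)"

(* The constant depends on the space only, which is passed as TYPE('a).
   For 0 <= t <= 1 the real supremum is genuine when the space is nontrivial: the set
   contains the value at (x, 0) for x \<noteq> 0 and is bounded above by 2, since
   x \<bottom>\<^sub>I y implies that norm x and norm y are at most norm (x + y). The denominator
   vanishes only at (0, 0), since x + y = 0 and x \<bottom>\<^sub>I y force x - y = 0. *)
definition L_const :: "'a::real_normed_vector itself \<Rightarrow> real \<Rightarrow> real" where
  "L_const _ t =
     Sup {((norm (t *\<^sub>R x + (1 - t) *\<^sub>R y))\<^sup>2 + (norm ((1 - t) *\<^sub>R x + t *\<^sub>R y))\<^sup>2)
            / (norm (x + y))\<^sup>2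
          | x y :: 'a. (x, y) \<noteq> (0, 0) \<and> x \<bottom>\<^sub>I y}"

(* The axioms are those of the class real_inner, stated for a function rather than for the
   overloaded operation, so that being an inner product space is a property of a given norm. *)
definition real_inner_product :: "('a::real_vector \<Rightarrow> 'a \<Rightarrow> real) \<Rightarrow> bool" where
  "real_inner_product ip \<longleftrightarrow>
     (\<forall>x y. ip x y = ip y x) \<and>
     (\<forall>x y z. ip (x + y) z = ip x z + ip y z) \<and>
     (\<forall>r x y. ip (r *\<^sub>R x) y = r * ip x y) \<and>
     (\<forall>x. 0 \<le> ip x x) \<and>
     (\<forall>x. ip x x = 0 \<longleftrightarrow> x = 0)"

(* Completeness is supplied by the class banach. *)
definition hilbert_space :: "'a::banach itself \<Rightarrow> bool" where
  "hilbert_space _ \<longleftrightarrow>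
     (\<exists>ip :: 'a \<Rightarrow> 'a \<Rightarrow> real. real_inner_product ip \<and> (\<forall>x. norm x = sqrt (ip x x)))"

(* Not phrased with dim, which is 0 for infinite-dimensional spaces. *)
definition dim_at_least :: "'a::real_vector itself \<Rightarrow> nat \<Rightarrow> bool" where
  "dim_at_least _ n \<longleftrightarrow> (\<exists>B :: 'a set. finite B \<and> independent B \<and> card B = n)"

end

theory Submission
  imports Defs
begin

text \<open>
  Put \<open>u = x + y\<close>, \<open>v = x - y\<close> and \<open>s = 1 - 2 * t\<close>. Then \<open>x \<bottom>\<^sub>I y\<close> says that \<open>u\<close> and \<open>v\<close> have the
  same norm, and the condition on \<open>L_X(t)\<close> becomes the rhombus inequality
  \<open>\<parallel>u + s v\<parallel>\<^sup>2 + \<parallel>u - s v\<parallel>\<^sup>2 \<le> 2 (1 + s\<^sup>2)\<close> for unit vectors \<open>u\<close>, \<open>v\<close>, with \<open>0 < s \<le> 1\<close>.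
  In a plane, take the ellipse of least area containing the unit ball, that is, a Euclidean norm
  below the given norm with maximal determinant; it touches the unit sphere in two independent
  directions. If \<open>u\<close> and \<open>v\<close> are contact points, then the rhombus inequality and the
  parallelogram law of the ellipse force \<open>u + s v\<close> to be a contact direction. It lies strictly
  between \<open>u\<close> and \<open>v\<close>, so the closed set of contact directions has no gaps, and the
  norm is Euclidean on every plane.
\<close>

section \<open>Auxiliary facts on the line and in the plane\<close>

text \<open>A missing point \<open>c\<close> would lie in a gap of \<open>S\<close>, bounded by the
  last point of \<open>S\<close> in \<open>{a..c}\<close> and the first one in
  \<open>{c..b}\<close>; \<open>between\<close> puts a point of \<open>S\<close> inside that
  gap.\<close>

lemma closed_dense_in_interval:
  fixes S :: "real set"
  assumes "closed S" "a \<in> S" "b \<in> S"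
    and between: "\<And>x y. x \<in> S \<Longrightarrow> y \<in> S \<Longrightarrow> a \<le> x \<Longrightarrow> x < y \<Longrightarrow> y \<le> b \<Longrightarrow> \<exists>z\<in>S. x < z \<and> z < y"
  shows "{a..b} \<subseteq> S"
proof
  fix c assume c: "c \<in> {a..b}"
  show "c \<in> S"
  proof (rule ccontr)
    assume nc: "c \<notin> S"
    have "compact (S \<inter> {a..c})" "compact (S \<inter> {c..b})"
      using assms(1) by (auto intro: closed_Int_compact)
    moreover have "S \<inter> {a..c} \<noteq> {}" "S \<inter> {c..b} \<noteq> {}" using assms c by auto
    ultimately obtain l r where l: "l \<in> S \<inter> {a..c}" "\<And>x. x \<in> S \<inter> {a..c} \<Longrightarrow> x \<le> l"
      and r: "r \<in> S \<inter> {c..b}" "\<And>x. x \<in> S \<inter> {c..b} \<Longrightarrow> r \<le> x"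
      using compact_attains_sup compact_attains_inf by metis
    have "l < c" "c < r" using l(1) r(1) nc by (auto simp: less_le)
    then obtain z where z: "z \<in> S" "l < z" "z < r" using between[of l r] l r by auto
    show False
    proof (cases "z \<le> c")
      case True then show ?thesis using l(2)[of z] z l(1) by auto
    next
      case False then show ?thesis using r(2)[of z] z r(1) by auto
    qed
  qed
qed

text \<open>Cramer's rule: \<open>Im (cnj w * z)\<close> is the determinant of \<open>w\<close> and
  \<open>z\<close>.\<close>

lemma linear_combination_complex:
  fixes w z c :: complex
  assumes "Im (cnj w * z) \<noteq> 0"
  obtains a b where "c = a *\<^sub>R w + b *\<^sub>R z"
proof
  define D where "D = Re w * Im z - Im w * Re z"
  have "D \<noteq> 0" using assms by (simp add: D_def)
  then show "c = ((Re c * Im z - Im c * Re z) / D) *\<^sub>R w + ((Re w * Im c - Im w * Re c) / D) *\<^sub>R z"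
    by (simp add: complex_eq_iff divide_simps) (simp add: D_def algebra_simps)
qed

section \<open>Ellipses of least area and their contact points\<close>

text \<open>Every real-linear map of the plane has the form \<open>z \<mapsto> \<alpha> * z + \<beta> * cnj z\<close>; its determinant is \<open>|\<alpha>|\<^sup>2 - |\<beta>|\<^sup>2\<close>.\<close>

lemma exists_extremal_ellipse:
  fixes T :: "complex \<Rightarrow> 'a::real_normed_vector"
  assumes T: "linear T" and inj: "\<And>z. T z = 0 \<Longrightarrow> z = 0"
  obtains T' where "linear T'" "range T \<subseteq> range T'" "\<And>z. cmod z \<le> norm (T' z)"
    "\<And>\<alpha> \<beta>. (\<And>z. cmod (\<alpha> * z + \<beta> * cnj z) \<le> norm (T' z)) \<Longrightarrow> (cmod \<alpha>)\<^sup>2 - (cmod \<beta>)\<^sup>2 \<le> 1"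
proof -
  \<comment> \<open>\<open>K\<close> collects the linear maps whose Euclidean seminorm stays below
    the pulled-back norm; maximizing \<open>det\<close> over this compact set minimizes the area of
    the ellipse.\<close>
  define K where "K = {q :: complex \<times> complex. \<forall>z. cmod (fst q * z + snd q * cnj z) \<le> norm (T z)}"
  define det where "det = (\<lambda>q :: complex \<times> complex. (cmod (fst q))\<^sup>2 - (cmod (snd q))\<^sup>2)"
  have contT: "continuous_on A T" for A
    using T by (simp add: linear_continuous_on linear_conv_bounded_linear)
  have "closed K" unfolding K_def
    by (intro closed_Collect_all closed_Collect_le continuous_intros)
  moreover have "bounded K"
  proof -
    \<comment> \<open>The values at \<open>1\<close> and \<open>\<i>\<close> control
      \<open>a + b\<close> and \<open>a - b\<close>, hence \<open>a\<close> and
      \<open>b\<close>.\<close>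
    define R where "R = norm (T 1) + norm (T \<i>)"
    have "cmod a \<le> R \<and> cmod b \<le> R" if "(a, b) \<in> K" for a b
    proof -
      have 1: "cmod (a + b) \<le> norm (T 1)"
        using that unfolding K_def by (auto dest: spec[of _ 1])
      have "cmod (a * \<i> + b * cnj \<i>) \<le> norm (T \<i>)"
        using that unfolding K_def by (auto dest: spec[of _ \<i>])
      moreover have "cmod (a * \<i> + b * cnj \<i>) = cmod (\<i> * (a - b))"
        by (simp add: algebra_simps)
      ultimately have 2: "cmod (a - b) \<le> norm (T \<i>)"
        by (simp add: norm_mult)
      have "cmod (2 * a) \<le> cmod (a + b) + cmod (a - b)" "cmod (2 * b) \<le> cmod (a + b) + cmod (a - b)"
        using norm_triangle_ineq[of "a + b" "a - b"] norm_triangle_ineq4[of "a + b" "a - b"]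
        by simp_all
      with 1 2 norm_ge_zero[of "T 1"] norm_ge_zero[of "T \<i>"] show ?thesis
        unfolding R_def norm_mult norm_numeral by linarith
    qed
    then have "K \<subseteq> cball 0 R \<times> cball 0 R" by auto
    then show ?thesis by (rule bounded_subset[OF bounded_Times[OF bounded_cball bounded_cball]])
  qed
  ultimately have "compact K" by (simp add: compact_eq_bounded_closed)
  moreover have "(0, 0) \<in> K" by (simp add: K_def)
  moreover have "continuous_on K det" unfolding det_def by (intro continuous_intros)
  ultimately obtain q where q: "q \<in> K" and qmax: "\<And>r. r \<in> K \<Longrightarrow> det r \<le> det q"
    using continuous_attains_sup[of K det] by blast
  obtain \<alpha> \<beta> where q_eq: "q = (\<alpha>, \<beta>)" by fastforce
  \<comment> \<open>Scaling by the least norm on the unit circle is a member of \<open>K\<close>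
    with positive determinant, so the maximizer is invertible.\<close>
  have "\<exists>e\<in>sphere 0 1. \<forall>z\<in>sphere 0 1. norm (T e) \<le> norm (T z)"
    by (rule continuous_attains_inf) (auto intro!: continuous_intros contT)
  then obtain e where e: "cmod e = 1" "\<And>z. cmod z = 1 \<Longrightarrow> norm (T e) \<le> norm (T z)" by auto
  have Te: "norm (T e) > 0" using inj[of e] e(1) by auto
  have "cmod (of_real (norm (T e)) * z) \<le> norm (T z)" for z
  proof (cases "z = 0")
    case False
    have "norm (T e) \<le> norm (T (inverse (cmod z) *\<^sub>R z))"
      by (rule e(2)) (use False in simp)
    also have "\<dots> = norm (T z) / cmod z"
      by (simp add: linear_cmul[OF T] divide_inverse mult.commute)
    finally show ?thesis using False by (simp add: norm_mult field_simps)
  qed simp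
  then have "(of_real (norm (T e)), 0) \<in> K" by (simp add: K_def)
  from qmax[OF this] have "(norm (T e))\<^sup>2 \<le> det q" by (simp add: det_def)
  with Te have "det q > 0" by (smt (verit) zero_less_power)
  define D where "D = (cmod \<alpha>)\<^sup>2 - (cmod \<beta>)\<^sup>2"
  have D: "D > 0" using \<open>det q > 0\<close> by (simp add: D_def det_def q_eq)
  have D_eq: "of_real D = \<alpha> * cnj \<alpha> - \<beta> * cnj \<beta>"
    unfolding D_def of_real_diff complex_norm_square ..
  \<comment> \<open>\<open>S\<close> is the maximizer and \<open>U\<close> its inverse;
    \<open>T \<circ> U\<close> turns the extremal ellipse into the unit disc.\<close>
  define S where "S = (\<lambda>z. \<alpha> * z + \<beta> * cnj z)"
  define U where "U = (\<lambda>w. inverse D *\<^sub>R (cnj \<alpha> * w - \<beta> * cnj w))"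
  have US: "U (S z) = z" for z
  proof -
    have "cnj \<alpha> * S z - \<beta> * cnj (S z) = of_real D * z"
      by (simp add: S_def D_eq algebra_simps)
    then show ?thesis using D by (simp add: U_def scaleR_conv_of_real)
  qed
  have SU: "S (U w) = w" for w
  proof -
    have "S (U w) = inverse D *\<^sub>R S (cnj \<alpha> * w - \<beta> * cnj w)"
      by (simp add: S_def U_def algebra_simps)
    also have "S (cnj \<alpha> * w - \<beta> * cnj w) = of_real D * w"
      by (simp add: S_def D_eq algebra_simps)
    finally show ?thesis using D by (simp add: scaleR_conv_of_real)
  qed
  have linU: "linear U"
    by (rule linearI) (simp_all add: U_def algebra_simps)
  show thesis
  proof
    show "linear (T \<circ> U)" by (rule linear_compose[OF linU T])
    show "range T \<subseteq> range (T \<circ> U)"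
      by (metis US comp_apply image_subsetI rangeI)
    show "cmod z \<le> norm ((T \<circ> U) z)" for z
    proof -
      have "cmod (S (U z)) \<le> norm (T (U z))" using q by (simp add: K_def S_def q_eq)
      then show ?thesis by (simp add: SU)
    qed
    fix \<gamma> \<delta> assume *: "\<And>z. cmod (\<gamma> * z + \<delta> * cnj z) \<le> norm ((T \<circ> U) z)"
    \<comment> \<open>The coefficients of the competitor composed with \<open>S\<close>.
      Determinants multiply, so maximality of \<open>D\<close> bounds the competitor's determinant
      by 1.\<close>
    define r where "r = (\<gamma> * \<alpha> + \<delta> * cnj \<beta>, \<gamma> * \<beta> + \<delta> * cnj \<alpha>)"
    have "r \<in> K"
    proof -
      have "cmod (fst r * z + snd r * cnj z) \<le> norm (T z)" for z
        using *[of "S z"] by (simp add: US) (simp add: S_def r_def algebra_simps)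
      then show ?thesis by (simp add: K_def)
    qed
    then have "det r \<le> D" using qmax by (simp add: D_def det_def q_eq)
    moreover have "complex_of_real (det r) = of_real (((cmod \<gamma>)\<^sup>2 - (cmod \<delta>)\<^sup>2) * D)"
      unfolding det_def D_def of_real_mult of_real_diff complex_norm_square r_def
      by (simp add: algebra_simps)
    ultimately have "((cmod \<gamma>)\<^sup>2 - (cmod \<delta>)\<^sup>2) * D \<le> 1 * D"
      by (simp only: of_real_eq_iff)
    then show "(cmod \<gamma>)\<^sup>2 - (cmod \<delta>)\<^sup>2 \<le> 1"
      using D by (simp only: mult_le_cancel_right_pos)
  qed
qed

text \<open>If all contact points were on the line through \<open>e\<close>, one could shrink the Euclidean norm slightly along
  \<open>e\<close> and stretch it twice as much across, which increases the determinant.\<close>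

lemma extremal_ellipse_contact:
  fixes T :: "complex \<Rightarrow> 'a::real_normed_vector"
  assumes T: "linear T" and le: "\<And>z. cmod z \<le> norm (T z)"
    and max: "\<And>\<alpha> \<beta>. (\<And>z. cmod (\<alpha> * z + \<beta> * cnj z) \<le> norm (T z)) \<Longrightarrow> (cmod \<alpha>)\<^sup>2 - (cmod \<beta>)\<^sup>2 \<le> 1"
  shows "\<exists>w z. norm (T w) = cmod w \<and> norm (T z) = cmod z \<and> Im (cnj w * z) \<noteq> 0"
proof (rule ccontr)
  assume "\<not> ?thesis"
  then have no: "\<And>w z. norm (T w) = cmod w \<Longrightarrow> norm (T z) = cmod z \<Longrightarrow> Im (cnj w * z) = 0"
    by blast
  have contT: "continuous_on A T" for A
    using T by (simp add: linear_continuous_on linear_conv_bounded_linear)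
  have scale: "norm (T (r *\<^sub>R z)) = \<bar>r\<bar> * norm (T z)" for r z
    by (simp add: linear_cmul[OF T])
  obtain e where e: "cmod e = 1"
    and contact: "\<And>z. cmod z = 1 \<Longrightarrow> norm (T z) = 1 \<Longrightarrow> Im (cnj e * z) = 0"
  proof (cases "\<exists>e. cmod e = 1 \<and> norm (T e) = 1")
    case True then show ?thesis using no that by metis
  next
    \<comment> \<open>Without unit contact points any unit \<open>e\<close> serves
      vacuously.\<close>
    case False then show ?thesis using that[of 1] by auto
  qed
  \<comment> \<open>The unit circle outside a double cone around the line of \<open>e\<close>. It is
    compact and free of contact points, so the norm has a minimum above 1 on it.\<close>
  define G where "G = {z \<in> sphere 0 1. \<bar>Re (cnj e * z)\<bar> \<le> 2 * \<bar>Im (cnj e * z)\<bar>}"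
  have "closed {z. \<bar>Re (cnj e * z)\<bar> \<le> 2 * \<bar>Im (cnj e * z)\<bar>}"
    by (intro closed_Collect_le continuous_intros)
  then have "compact G"
    unfolding G_def Collect_conj_eq Collect_mem_eq by (rule compact_Int_closed[OF compact_sphere])
  moreover have "\<i> * e \<in> G"
  proof -
    have "cnj e * (\<i> * e) = \<i> * of_real ((cmod e)\<^sup>2)" unfolding complex_norm_square by simp
    then show ?thesis using e by (simp add: G_def norm_mult)
  qed
  ultimately have "\<exists>m\<in>G. \<forall>z\<in>G. norm (T m) \<le> norm (T z)"
    by (intro continuous_attains_inf) (auto intro!: continuous_intros contT)
  then obtain m where m: "m \<in> G" "\<And>z. z \<in> G \<Longrightarrow> norm (T m) \<le> norm (T z)" by blast
  have "norm (T m) > 1"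
  proof -
    have m1: "cmod m = 1" using m(1) by (simp add: G_def)
    have "norm (T m) \<noteq> 1"
    proof
      assume "norm (T m) = 1"
      then have "cnj e * m = 0"
        using contact[OF m1] m(1) by (intro complex_eqI) (auto simp: G_def)
      then show False using e m1 by auto
    qed
    then show ?thesis using le[of m] m1 by linarith
  qed
  define \<epsilon> where "\<epsilon> = min (1/4) ((norm (T m) - 1) / 2)"
  have \<epsilon>: "0 < \<epsilon>" "\<epsilon> \<le> 1/4" "1 + 2 * \<epsilon> \<le> norm (T m)"
    using \<open>norm (T m) > 1\<close> by (auto simp: \<epsilon>_def min_def field_simps)
  \<comment> \<open>In the rotated coordinates \<open>x\<close>, \<open>y\<close> of
    \<open>cnj e * z\<close> the map is diagonal with entries \<open>1 - \<epsilon>\<close> and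
    \<open>1 + 2 * \<epsilon>\<close>; half their sum and half their difference give the two
    coefficients.\<close>
  define \<alpha> where "\<alpha> = of_real (1 + \<epsilon> / 2) * cnj e"
  define \<beta> where "\<beta> = of_real (- (3 * \<epsilon> / 2)) * e"
  have "cmod (\<alpha> * z + \<beta> * cnj z) \<le> norm (T z)" for z
  proof -
    define x where "x = Re (cnj e * z)"
    define y where "y = Im (cnj e * z)"
    have "cmod (cnj e * z) = cmod z" using e by (simp add: norm_mult)
    then have xy: "x\<^sup>2 + y\<^sup>2 = (cmod z)\<^sup>2" unfolding x_def y_def cmod_power2[of "cnj e * z", symmetric] by simp
    have "\<alpha> * z + \<beta> * cnj z = of_real (1 + \<epsilon> / 2) * (cnj e * z) + of_real (- (3 * \<epsilon> / 2)) * cnj (cnj e * z)"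
      by (simp add: \<alpha>_def \<beta>_def)
    also have "\<dots> = Complex ((1 - \<epsilon>) * x) ((1 + 2 * \<epsilon>) * y)"
      unfolding x_def y_def by (rule complex_eqI) (simp_all add: field_simps)
    finally have S: "(cmod (\<alpha> * z + \<beta> * cnj z))\<^sup>2 = ((1 - \<epsilon>) * x)\<^sup>2 + ((1 + 2 * \<epsilon>) * y)\<^sup>2"
      by (simp add: cmod_power2)
    \<comment> \<open>Inside the cone \<open>4 * y\<^sup>2 \<le> x\<^sup>2\<close>, so the loss
      along \<open>e\<close> outweighs the gain across; outside it the stretch by at most
      \<open>1 + 2 * \<epsilon>\<close> is covered by the minimum on \<open>G\<close>.\<close>
    have "(cmod (\<alpha> * z + \<beta> * cnj z))\<^sup>2 \<le> (norm (T z))\<^sup>2"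
    proof (cases "\<bar>x\<bar> \<le> 2 * \<bar>y\<bar>")
      case False
      then have "\<bar>2 * y\<bar> \<le> \<bar>x\<bar>" by (simp add: abs_mult)
      then have "4 * y\<^sup>2 \<le> x\<^sup>2" by (simp only: abs_le_square_iff power_mult_distrib) simp
      moreover have "(1 - \<epsilon>)\<^sup>2 * x\<^sup>2 + (1 + 2 * \<epsilon>)\<^sup>2 * y\<^sup>2
          = x\<^sup>2 + y\<^sup>2 - \<epsilon> * (2 - \<epsilon>) * (x\<^sup>2 - 4 * y\<^sup>2) - \<epsilon> * (4 - 8 * \<epsilon>) * y\<^sup>2"
        by (simp add: power2_eq_square algebra_simps)
      moreover have "0 \<le> \<epsilon> * (2 - \<epsilon>) * (x\<^sup>2 - 4 * y\<^sup>2)" "0 \<le> \<epsilon> * (4 - 8 * \<epsilon>) * y\<^sup>2"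
        using \<epsilon> \<open>4 * y\<^sup>2 \<le> x\<^sup>2\<close> by auto
      ultimately have "((1 - \<epsilon>) * x)\<^sup>2 + ((1 + 2 * \<epsilon>) * y)\<^sup>2 \<le> (cmod z)\<^sup>2"
        using xy by (simp add: power_mult_distrib)
      also have "\<dots> \<le> (norm (T z))\<^sup>2" using le by (simp add: power_mono)
      finally show ?thesis using S by simp
    next
      case True
      have "(1 + 2 * \<epsilon>) * cmod z \<le> norm (T z)"
      proof (cases "z = 0")
        case False
        have "cnj e * (inverse (cmod z) *\<^sub>R z) = inverse (cmod z) *\<^sub>R (cnj e * z)"
          by simp
        then have "Re (cnj e * (inverse (cmod z) *\<^sub>R z)) = inverse (cmod z) * x"
          "Im (cnj e * (inverse (cmod z) *\<^sub>R z)) = inverse (cmod z) * y"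
          by (simp_all only: x_def y_def scaleR_complex.simps)
        moreover have "\<bar>inverse (cmod z) * x\<bar> \<le> 2 * \<bar>inverse (cmod z) * y\<bar>"
          using mult_left_mono[OF True, of "inverse (cmod z)"] by (simp add: abs_mult)
        ultimately have "inverse (cmod z) *\<^sub>R z \<in> G"
          using False unfolding G_def mem_Collect_eq by (simp only:) simp
        then have "1 + 2 * \<epsilon> \<le> norm (T (inverse (cmod z) *\<^sub>R z))"
          using m(2) \<epsilon>(3) by fastforce
        then show ?thesis using False by (simp add: scale field_simps)
      qed simp
      then have "((1 + 2 * \<epsilon>) * cmod z)\<^sup>2 \<le> (norm (T z))\<^sup>2"
        using \<epsilon> by (intro power_mono) auto
      moreover have "(1 - \<epsilon>)\<^sup>2 * x\<^sup>2 \<le> (1 + 2 * \<epsilon>)\<^sup>2 * x\<^sup>2"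
        using \<epsilon> by (intro mult_right_mono power_mono) auto
      ultimately show ?thesis
        unfolding S power_mult_distrib xy[symmetric] by (simp add: distrib_left)
    qed
    then show ?thesis by (rule power2_le_imp_le) simp
  qed
  then have "(cmod \<alpha>)\<^sup>2 - (cmod \<beta>)\<^sup>2 \<le> 1" by (rule max)
  moreover have "cmod \<alpha> = 1 + \<epsilon> / 2" "cmod \<beta> = 3 * \<epsilon> / 2"
    unfolding \<alpha>_def \<beta>_def norm_mult norm_of_real using e \<epsilon> by auto
  \<comment> \<open>The determinant is \<open>(1 - \<epsilon>) * (1 + 2 * \<epsilon>) = 1 +
    \<epsilon> * (1 - 2 * \<epsilon>)\<close>.\<close>
  ultimately have "\<epsilon> * (1 - 2 * \<epsilon>) \<le> 0"
    by (simp add: power2_eq_square algebra_simps)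
  moreover have "0 < \<epsilon> * (1 - 2 * \<epsilon>)" using \<epsilon> by (intro mult_pos_pos) auto
  ultimately show False by simp
qed

section \<open>Contact directions under the rhombus inequality\<close>

lemma parallelogram_scaled:
  fixes u v :: "'a::real_inner"
  assumes "norm u = 1" "norm v = 1"
  shows "(norm (u + s *\<^sub>R v))\<^sup>2 + (norm (u - s *\<^sub>R v))\<^sup>2 = 2 * (1 + s\<^sup>2)"
proof -
  have "u \<bullet> u = 1" "v \<bullet> v = 1" using assms by (simp_all add: norm_eq_1)
  then show ?thesis
    unfolding power2_norm_eq_inner
    by (simp add: inner_add_left inner_add_right inner_diff_left inner_diff_right
        inner_commute power2_eq_square)
qed

text \<open>For the normalized vectors \<open>u\<close>, \<open>v\<close> the rhombus inequality
  bounds the sum of the two squared norms by its Euclidean value, while each term is at least its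
  Euclidean counterpart. Hence both are equal.\<close>

lemma rhombus_contact:
  fixes T :: "complex \<Rightarrow> 'a::real_normed_vector"
  assumes T: "linear T" and le: "\<And>z. cmod z \<le> norm (T z)"
    and rhombus: "\<And>u v::'a. norm u = 1 \<Longrightarrow> norm v = 1 \<Longrightarrow>
          (norm (u + s *\<^sub>R v))\<^sup>2 + (norm (u - s *\<^sub>R v))\<^sup>2 \<le> 2 * (1 + s\<^sup>2)"
    and "norm (T w) = cmod w" "w \<noteq> 0" "norm (T z) = cmod z" "z \<noteq> 0"
  shows "norm (T ((1 / cmod w) *\<^sub>R w + (s / cmod z) *\<^sub>R z)) = cmod ((1 / cmod w) *\<^sub>R w + (s / cmod z) *\<^sub>R z)"
proof -
  define u where "u = (1 / cmod w) *\<^sub>R w"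
  define v where "v = (1 / cmod z) *\<^sub>R z"
  have 1: "cmod u = 1" "cmod v = 1" using assms by (simp_all add: u_def v_def)
  have 2: "norm (T u) = 1" "norm (T v) = 1"
    using assms by (simp_all add: u_def v_def linear_cmul[OF T])
  have "(norm (T (u + s *\<^sub>R v)))\<^sup>2 + (norm (T (u - s *\<^sub>R v)))\<^sup>2 \<le> 2 * (1 + s\<^sup>2)"
    using rhombus[OF 2] by (simp add: linear_add[OF T] linear_diff[OF T] linear_cmul[OF T])
  moreover have "2 * (1 + s\<^sup>2) = (cmod (u + s *\<^sub>R v))\<^sup>2 + (cmod (u - s *\<^sub>R v))\<^sup>2"
    using parallelogram_scaled[OF 1] by simp
  moreover have "(cmod (u - s *\<^sub>R v))\<^sup>2 \<le> (norm (T (u - s *\<^sub>R v)))\<^sup>2"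
    by (intro power_mono le) simp
  ultimately have "(norm (T (u + s *\<^sub>R v)))\<^sup>2 \<le> (cmod (u + s *\<^sub>R v))\<^sup>2"
    by linarith
  then have "norm (T (u + s *\<^sub>R v)) = cmod (u + s *\<^sub>R v)"
    by (intro antisym le) (rule power2_le_imp_le, simp_all)
  then show ?thesis by (simp add: u_def v_def)
qed

lemma rhombus_contact_segment:
  fixes T :: "complex \<Rightarrow> 'a::real_normed_vector"
  assumes T: "linear T" and le: "\<And>z. cmod z \<le> norm (T z)" and "s > 0"
    and rhombus: "\<And>u v::'a. norm u = 1 \<Longrightarrow> norm v = 1 \<Longrightarrow>
          (norm (u + s *\<^sub>R v))\<^sup>2 + (norm (u - s *\<^sub>R v))\<^sup>2 \<le> 2 * (1 + s\<^sup>2)"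
    and w: "norm (T w) = cmod w" and z: "norm (T z) = cmod z" and indep: "Im (cnj w * z) \<noteq> 0"
    and ab: "a \<ge> 0" "b \<ge> 0"
  shows "norm (T (a *\<^sub>R w + b *\<^sub>R z)) = cmod (a *\<^sub>R w + b *\<^sub>R z)"
proof -
  have contT: "continuous_on A T" for A
    using T by (simp add: linear_continuous_on linear_conv_bounded_linear)
  have scale: "norm (T (r *\<^sub>R x)) = cmod (r *\<^sub>R x) \<longleftrightarrow> r = 0 \<or> norm (T x) = cmod x" for r x
    by (auto simp: linear_cmul[OF T] linear_0[OF T])
  define p where "p = (\<lambda>l::real. (1 - l) *\<^sub>R w + l *\<^sub>R z)"
  define S where "S = {l. norm (T (p l)) = cmod (p l)}"
  have p0: "p l \<noteq> 0" for l
  proof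
    assume "p l = 0"
    then have "cnj w * p l = 0" "cnj z * p l = 0" by simp_all
    moreover have "Im (cnj w * p l) = l * Im (cnj w * z)" "Im (cnj z * p l) = - (1 - l) * Im (cnj w * z)"
      by (simp_all add: p_def algebra_simps)
    ultimately have "l = 0" "l = 1" using indep by auto
    then show False by simp
  qed
  have "{0..1} \<subseteq> S"
  proof (rule closed_dense_in_interval)
    have "continuous_on UNIV (\<lambda>l. T (p l))"
      by (rule continuous_on_compose2[OF contT[of UNIV]]) (auto simp: p_def intro!: continuous_intros)
    then show "closed S" unfolding S_def p_def
      by (intro closed_Collect_eq continuous_intros)
    show "0 \<in> S" "1 \<in> S" using w z by (simp_all add: S_def p_def)
  next
    fix l r :: real assume lr: "l \<in> S" "r \<in> S" "l < r"
    \<comment> \<open>With these weights \<open>rhombus_contact\<close> applies to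
      \<open>p l\<close> and \<open>p r\<close>. As \<open>p\<close> is affine, the resulting vector
      is a positive multiple of \<open>p k\<close> for the weighted mean \<open>k\<close>.\<close>
    define c where "c = 1 / cmod (p l)"
    define d where "d = s / cmod (p r)"
    have cd: "c > 0" "d > 0" using p0 \<open>s > 0\<close> by (auto simp: c_def d_def)
    define k where "k = (c * l + d * r) / (c + d)"
    have k: "(c + d) * k = c * l + d * r" using cd by (simp add: k_def)
    have "(c + d) *\<^sub>R p k = (c + d - (c + d) * k) *\<^sub>R w + ((c + d) * k) *\<^sub>R z"
      by (simp add: p_def algebra_simps)
    also have "\<dots> = c *\<^sub>R p l + d *\<^sub>R p r"
      unfolding k by (simp add: p_def algebra_simps)
    finally have pk: "(c + d) *\<^sub>R p k = c *\<^sub>R p l + d *\<^sub>R p r" .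
    have "norm (T (c *\<^sub>R p l + d *\<^sub>R p r)) = cmod (c *\<^sub>R p l + d *\<^sub>R p r)"
      unfolding c_def d_def
      by (rule rhombus_contact[OF T le rhombus]) (use lr p0 in \<open>simp_all add: S_def\<close>)
    then have "k \<in> S" using cd unfolding pk[symmetric] scale by (simp add: S_def)
    moreover have "l < k" "k < r"
      using cd lr(3) by (simp_all add: k_def field_simps)
    ultimately show "\<exists>k\<in>S. l < k \<and> k < r" by blast
  qed
  show ?thesis
  proof (cases "a + b = 0")
    case True then show ?thesis using ab by (simp add: add_nonneg_eq_0_iff linear_0[OF T])
  next
    case False
    then have "b / (a + b) \<in> S" using \<open>{0..1} \<subseteq> S\<close> ab by (auto simp: field_simps)
    moreover have "a *\<^sub>R w + b *\<^sub>R z = (a + b) *\<^sub>R p (b / (a + b))"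
      using False by (simp add: p_def scaleR_add_right right_diff_distrib)
    ultimately show ?thesis by (simp only: scale S_def) simp
  qed
qed

lemma rhombus_contact_everywhere:
  fixes T :: "complex \<Rightarrow> 'a::real_normed_vector"
  assumes T: "linear T" and le: "\<And>z. cmod z \<le> norm (T z)" and s: "s > 0"
    and rhombus: "\<And>u v::'a. norm u = 1 \<Longrightarrow> norm v = 1 \<Longrightarrow>
          (norm (u + s *\<^sub>R v))\<^sup>2 + (norm (u - s *\<^sub>R v))\<^sup>2 \<le> 2 * (1 + s\<^sup>2)"
    and w: "norm (T w) = cmod w" and z: "norm (T z) = cmod z" and indep: "Im (cnj w * z) \<noteq> 0"
  shows "norm (T c) = cmod c"
proof -
  obtain a b where c: "c = a *\<^sub>R w + b *\<^sub>R z" using linear_combination_complex[OF indep] .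
  \<comment> \<open>The four cones spanned by \<open>w\<close> or \<open>-w\<close> and
    \<open>z\<close> or \<open>-z\<close> cover the plane. The sign at 0 is 1, unlike
    \<open>sgn\<close>, to keep the generators independent.\<close>
  define \<sigma> where "\<sigma> = (\<lambda>a::real. if a < 0 then -1 else 1 :: real)"
  have \<sigma>: "\<bar>a\<bar> * \<sigma> a = a" "\<bar>\<sigma> a\<bar> = 1" "\<sigma> a \<noteq> 0" for a by (simp_all add: \<sigma>_def)
  have "norm (T (\<sigma> a *\<^sub>R w)) = cmod (\<sigma> a *\<^sub>R w)" "norm (T (\<sigma> b *\<^sub>R z)) = cmod (\<sigma> b *\<^sub>R z)"
    using w z by (simp_all add: linear_cmul[OF T])
  moreover have "Im (cnj (\<sigma> a *\<^sub>R w) * (\<sigma> b *\<^sub>R z)) = \<sigma> a * \<sigma> b * Im (cnj w * z)"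
    by (simp add: algebra_simps)
  then have "Im (cnj (\<sigma> a *\<^sub>R w) * (\<sigma> b *\<^sub>R z)) \<noteq> 0" using indep \<sigma>(3) by simp
  ultimately have "norm (T (\<bar>a\<bar> *\<^sub>R \<sigma> a *\<^sub>R w + \<bar>b\<bar> *\<^sub>R \<sigma> b *\<^sub>R z)) = cmod (\<bar>a\<bar> *\<^sub>R \<sigma> a *\<^sub>R w + \<bar>b\<bar> *\<^sub>R \<sigma> b *\<^sub>R z)"
    by (intro rhombus_contact_segment[OF T le s rhombus]) auto
  then show ?thesis by (simp only: scaleR_scaleR \<sigma>(1) c)
qed

section \<open>From quadratic norms on planes to an inner product\<close>

lemma rhombus_imp_quadratic_norm:
  fixes x y :: "'a::real_normed_vector"
  assumes s: "s > 0"
    and rhombus: "\<And>u v::'a. norm u = 1 \<Longrightarrow> norm v = 1 \<Longrightarrow>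
          (norm (u + s *\<^sub>R v))\<^sup>2 + (norm (u - s *\<^sub>R v))\<^sup>2 \<le> 2 * (1 + s\<^sup>2)"
  obtains A B C where "\<And>a b. (norm (a *\<^sub>R x + b *\<^sub>R y))\<^sup>2 = A * a\<^sup>2 + 2 * B * a * b + C * b\<^sup>2"
proof (cases "\<exists>a b. (a, b) \<noteq> (0, 0) \<and> a *\<^sub>R x + b *\<^sub>R y = 0")
  \<comment> \<open>Dependent \<open>x\<close> and \<open>y\<close> are multiples of one vector, so
    the form has rank at most one.\<close>
  case True
  have "\<exists>w c d. x = c *\<^sub>R w \<and> y = d *\<^sub>R w"
  proof -
    obtain a b where ab: "(a, b) \<noteq> (0, 0)" "a *\<^sub>R x + b *\<^sub>R y = 0" using True by blast
    show ?thesis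
    proof (cases "a = 0")
      case True
      then have "y = 0 *\<^sub>R x" using ab by auto
      then show ?thesis by (metis scaleR_one)
    next
      case False
      have "x = (- b / a) *\<^sub>R y"
      proof -
        have "a *\<^sub>R x = - b *\<^sub>R y" using ab(2) by (simp add: eq_neg_iff_add_eq_0)
        then have "inverse a *\<^sub>R a *\<^sub>R x = inverse a *\<^sub>R - b *\<^sub>R y" by (rule arg_cong)
        then show ?thesis using False by (simp add: divide_inverse mult.commute)
      qed
      then show ?thesis by (metis scaleR_one)
    qed
  qed
  then obtain w c d where w: "x = c *\<^sub>R w" "y = d *\<^sub>R w" by blast
  show ?thesis
  proof (rule that)
    fix a b
    have "a *\<^sub>R x + b *\<^sub>R y = (a * c + b * d) *\<^sub>R w" by (simp add: w scaleR_left_distrib)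
    then have "(norm (a *\<^sub>R x + b *\<^sub>R y))\<^sup>2 = (a * c + b * d)\<^sup>2 * (norm w)\<^sup>2"
      by (simp add: power_mult_distrib)
    then show "(norm (a *\<^sub>R x + b *\<^sub>R y))\<^sup>2 = (c\<^sup>2 * (norm w)\<^sup>2) * a\<^sup>2 + 2 * (c * d * (norm w)\<^sup>2) * a * b + (d\<^sup>2 * (norm w)\<^sup>2) * b\<^sup>2"
      by (simp add: power2_eq_square algebra_simps)
  qed
next
  case False
  define T where "T = (\<lambda>z. Re z *\<^sub>R x + Im z *\<^sub>R y)"
  have "linear T" by (rule linearI) (simp_all add: T_def algebra_simps)
  moreover have "T z = 0 \<Longrightarrow> z = 0" for z
    using False by (auto simp: T_def complex_eq_iff)
  ultimately obtain T' where T': "linear T'" "range T \<subseteq> range T'" "\<And>z. cmod z \<le> norm (T' z)"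
    "\<And>\<alpha> \<beta>. (\<And>z. cmod (\<alpha> * z + \<beta> * cnj z) \<le> norm (T' z)) \<Longrightarrow> (cmod \<alpha>)\<^sup>2 - (cmod \<beta>)\<^sup>2 \<le> 1"
    using exists_extremal_ellipse by blast
  \<comment> \<open>Two independent contact points spread contact to the whole plane, so
    \<open>T'\<close> is an isometry and the form below is the Gram form of preimages of
    \<open>x\<close> and \<open>y\<close>.\<close>
  have iso: "norm (T' c) = cmod c" for c
    using extremal_ellipse_contact[OF T'(1,3,4)]
      rhombus_contact_everywhere[OF T'(1,3) s rhombus] by blast
  have "T 1 \<in> range T'" "T \<i> \<in> range T'" using T'(2) by blast+
  then obtain c d where cd: "x = T' c" "y = T' d" by (auto simp: T_def)
  show ?thesis
  proof (rule that)
    fix a b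
    have "norm (a *\<^sub>R x + b *\<^sub>R y) = norm (a *\<^sub>R c + b *\<^sub>R d)"
      using iso[of "a *\<^sub>R c + b *\<^sub>R d"] by (simp add: cd linear_add[OF T'(1)] linear_cmul[OF T'(1)])
    then have "(norm (a *\<^sub>R x + b *\<^sub>R y))\<^sup>2 = (a *\<^sub>R c + b *\<^sub>R d) \<bullet> (a *\<^sub>R c + b *\<^sub>R d)"
      by (simp only: power2_norm_eq_inner)
    then show "(norm (a *\<^sub>R x + b *\<^sub>R y))\<^sup>2 = (c \<bullet> c) * a\<^sup>2 + 2 * (c \<bullet> d) * a * b + (d \<bullet> d) * b\<^sup>2"
      by (simp add: inner_add_left inner_add_right inner_commute power2_eq_square algebra_simps)
  qed
qed

text \<open>The homogeneity of the polarization form, usually obtained by density of the rationals, is read off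
  the plane spanned by the two vectors; it also allows halving in the proof of additivity.\<close>

lemma quadratic_norm_imp_hilbert_space:
  assumes quad: "\<And>x y::'a::banach. \<exists>A B C. \<forall>a b.
      (norm (a *\<^sub>R x + b *\<^sub>R y))\<^sup>2 = A * a\<^sup>2 + 2 * B * a * b + C * b\<^sup>2"
  shows "hilbert_space TYPE('a)"
proof -
  define ip where "ip = (\<lambda>x y::'a. ((norm (x + y))\<^sup>2 - (norm (x - y))\<^sup>2) / 4)"
  have para: "(norm (x + y))\<^sup>2 + (norm (x - y))\<^sup>2 = 2 * (norm x)\<^sup>2 + 2 * (norm y)\<^sup>2" for x y :: 'a
  proof -
    obtain A B C where *: "\<And>a b. (norm (a *\<^sub>R x + b *\<^sub>R y))\<^sup>2 = A * a\<^sup>2 + 2 * B * a * b + C * b\<^sup>2"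
      using quad by metis
    show ?thesis using *[of 1 1] *[of 1 "-1"] *[of 1 0] *[of 0 1] by simp
  qed
  have homog: "ip (r *\<^sub>R x) y = r * ip x y" for r x y
  proof -
    obtain A B C where *: "\<And>a b. (norm (a *\<^sub>R x + b *\<^sub>R y))\<^sup>2 = A * a\<^sup>2 + 2 * B * a * b + C * b\<^sup>2"
      using quad by metis
    show ?thesis
      using *[of 1 1] *[of 1 "-1"] *[of r 1] *[of r "-1"] by (simp add: ip_def)
  qed
  \<comment> \<open>The difference of two parallelogram laws.\<close>
  have sum_diff: "ip (x + z) y + ip (x - z) y = 2 * ip x y" for x y z
    using para[of "x + y" z] para[of "x - y" z]
    by (simp add: ip_def diff_divide_distrib algebra_simps)
  have "ip (x + z) y = ip x y + ip z y" for x y z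
  proof -
    have "ip x y + ip z y = 2 * ip ((1/2) *\<^sub>R (x + z)) y"
      using sum_diff[of "(1/2) *\<^sub>R (x + z)" "(1/2) *\<^sub>R (x - z)" y]
      by (simp add: scaleR_add_right[symmetric] scaleR_diff_right[symmetric] scaleR_2[symmetric])
    then show ?thesis by (simp add: homog)
  qed
  moreover have "ip x y = ip y x" for x y
    by (simp add: ip_def add.commute norm_minus_commute)
  moreover have self: "ip x x = (norm x)\<^sup>2" for x
    by (simp add: ip_def scaleR_2[symmetric] power_mult_distrib)
  ultimately have "real_inner_product ip" using homog by (simp add: real_inner_product_def)
  then show ?thesis unfolding hilbert_space_def using self by (intro exI[of _ ip]) simp
qed

lemma hilbert_space_parallelogram:
  assumes "hilbert_space TYPE('a::banach)"
  shows "(norm (u + s *\<^sub>R v))\<^sup>2 + (norm (u - s *\<^sub>R v))\<^sup>2 = 2 * (norm u)\<^sup>2 + 2 * s\<^sup>2 * (norm (v::'a))\<^sup>2"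
proof -
  obtain ip :: "'a \<Rightarrow> 'a \<Rightarrow> real" where ip: "real_inner_product ip" "\<And>x. norm x = sqrt (ip x x)"
    using assms by (auto simp: hilbert_space_def)
  have sym: "\<And>x y. ip x y = ip y x"
    and add: "\<And>x y z. ip (x + y) z = ip x z + ip y z"
    and homog: "\<And>r x y. ip (r *\<^sub>R x) y = r * ip x y"
    and "\<And>x. 0 \<le> ip x x"
    using ip(1) unfolding real_inner_product_def by blast+
  then have sq: "\<And>x. (norm x)\<^sup>2 = ip x x" by (simp add: ip(2))
  have expand: "(norm (u + r *\<^sub>R v))\<^sup>2 = ip u u + 2 * r * ip u v + r\<^sup>2 * ip v v" for r
  proof -
    have "ip u (u + r *\<^sub>R v) = ip u u + r * ip u v" "ip v (u + r *\<^sub>R v) = ip u v + r * ip v v"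
      using sym[of u "u + r *\<^sub>R v"] sym[of v "u + r *\<^sub>R v"] sym[of v u] by (simp_all add: add homog)
    then show ?thesis unfolding sq add homog by (simp add: power2_eq_square algebra_simps)
  qed
  show ?thesis using expand[of s] expand[of "- s"] by (simp add: sq)
qed

section \<open>The constant \<open>L_const\<close> and the rhombus inequality\<close>

lemma isosceles_quotient:
  fixes x y :: "'a::real_normed_vector"
  shows "((norm (t *\<^sub>R x + (1 - t) *\<^sub>R y))\<^sup>2 + (norm ((1 - t) *\<^sub>R x + t *\<^sub>R y))\<^sup>2) / (norm (x + y))\<^sup>2
    = ((norm ((x + y) + (1 - 2 * t) *\<^sub>R (x - y)))\<^sup>2 + (norm ((x + y) - (1 - 2 * t) *\<^sub>R (x - y)))\<^sup>2)
      / (4 * (norm (x + y))\<^sup>2)"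
proof -
  have "(x + y) + (1 - 2 * t) *\<^sub>R (x - y) = 2 *\<^sub>R ((1 - t) *\<^sub>R x + t *\<^sub>R y)"
    "(x + y) - (1 - 2 * t) *\<^sub>R (x - y) = 2 *\<^sub>R (t *\<^sub>R x + (1 - t) *\<^sub>R y)"
    by (simp_all add: algebra_simps scaleR_2)
  then show ?thesis by (simp add: power_mult_distrib add.commute add_divide_distrib)
qed

lemma isosceles_orthogonal_add_eq_0:
  assumes "x \<bottom>\<^sub>I y" "x + y = 0"
  shows "(x, y) = (0, 0)"
proof -
  have "x - y = 0" using assms by (simp add: isosceles_orthogonal_def)
  with assms(2) have "2 *\<^sub>R x = 0" by (simp add: scaleR_2)
  then show ?thesis using assms(2) by simp
qed

text \<open>By the parallelogram law all quotients equal
  \<open>(1 + (1 - 2 * t)\<^sup>2) / 2\<close>; the pair \<open>(x0, 0)\<close> shows that there is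
  one.\<close>

lemma L_const_hilbert:
  assumes "hilbert_space TYPE('a::banach)" and x0: "(x0::'a) \<noteq> 0"
  shows "L_const TYPE('a) t = 2 * t\<^sup>2 - 2 * t + 1"
proof -
  have "((norm (t *\<^sub>R x + (1 - t) *\<^sub>R y))\<^sup>2 + (norm ((1 - t) *\<^sub>R x + t *\<^sub>R y))\<^sup>2) / (norm (x + y))\<^sup>2
      = 2 * t\<^sup>2 - 2 * t + 1" if "(x, y) \<noteq> (0, 0)" "x \<bottom>\<^sub>I y" for x y :: 'a
  proof -
    have "norm (x + y) \<noteq> 0" using isosceles_orthogonal_add_eq_0 that by auto
    moreover have "norm (x - y) = norm (x + y)" using that by (simp add: isosceles_orthogonal_def)
    ultimately show ?thesis
      unfolding isosceles_quotient hilbert_space_parallelogram[OF assms(1)]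
      by (simp add: field_simps power2_eq_square)
  qed
  moreover have "(x0, 0) \<noteq> (0, 0)" "x0 \<bottom>\<^sub>I 0" using x0 by (auto simp: isosceles_orthogonal_def)
  ultimately have "{((norm (t *\<^sub>R x + (1 - t) *\<^sub>R y))\<^sup>2 + (norm ((1 - t) *\<^sub>R x + t *\<^sub>R y))\<^sup>2)
            / (norm (x + y))\<^sup>2 | x y :: 'a. (x, y) \<noteq> (0, 0) \<and> x \<bottom>\<^sub>I y} = {2 * t\<^sup>2 - 2 * t + 1}"
    unfolding set_eq_iff singleton_iff mem_Collect_eq by metis
  then show ?thesis by (simp add: L_const_def)
qed

lemma rhombus_le_L_const:
  fixes u v :: "'a::real_normed_vector"
  assumes t: "0 \<le> t" "t \<le> 1" and u: "norm u = 1" and v: "norm v = 1"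
  shows "(norm (u + (1 - 2 * t) *\<^sub>R v))\<^sup>2 + (norm (u - (1 - 2 * t) *\<^sub>R v))\<^sup>2 \<le> 4 * L_const TYPE('a) t"
proof -
  let ?f = "\<lambda>x y::'a. ((norm (t *\<^sub>R x + (1 - t) *\<^sub>R y))\<^sup>2 + (norm ((1 - t) *\<^sub>R x + t *\<^sub>R y))\<^sup>2)
            / (norm (x + y))\<^sup>2"
  let ?S = "{?f x y | x y. (x, y) \<noteq> (0, 0) \<and> x \<bottom>\<^sub>I y}"
  \<comment> \<open>A real \<open>Sup\<close> dominates its members only for a bounded set; here the
    triangle inequality and \<open>\<bar>1 - 2 * t\<bar> \<le> 1\<close> give the bound.\<close>
  have "?f x y \<le> 2" if "(x, y) \<noteq> (0, 0)" "x \<bottom>\<^sub>I y" for x y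
  proof -
    define n where "n = norm (x + y)"
    have n: "n > 0" using isosceles_orthogonal_add_eq_0 that by (auto simp: n_def)
    have "norm (x - y) = n" using that by (simp add: isosceles_orthogonal_def n_def)
    then have "norm ((1 - 2 * t) *\<^sub>R (x - y)) \<le> n"
      using t n by (auto intro!: mult_left_le_one_le)
    then have "norm ((x + y) + (1 - 2 * t) *\<^sub>R (x - y)) \<le> 2 * n"
      "norm ((x + y) - (1 - 2 * t) *\<^sub>R (x - y)) \<le> 2 * n"
      using norm_triangle_ineq[of "x + y" "(1 - 2 * t) *\<^sub>R (x - y)"]
        norm_triangle_ineq4[of "x + y" "(1 - 2 * t) *\<^sub>R (x - y)"] by (simp_all add: n_def)
    then have "(norm ((x + y) + (1 - 2 * t) *\<^sub>R (x - y)))\<^sup>2 + (norm ((x + y) - (1 - 2 * t) *\<^sub>R (x - y)))\<^sup>2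
        \<le> (2 * n)\<^sup>2 + (2 * n)\<^sup>2"
      by (intro add_mono power_mono) auto
    then show ?thesis
      unfolding isosceles_quotient unfolding n_def[symmetric] using n by (simp add: pos_divide_le_eq power_mult_distrib)
  qed
  then have bdd: "bdd_above ?S" by (auto simp: bdd_above_def)
  \<comment> \<open>Half-sum and half-difference undo the substitution; equal norms of
    \<open>u\<close> and \<open>v\<close> become \<open>x \<bottom>\<^sub>I y\<close>.\<close>
  define x where "x = (1/2) *\<^sub>R (u + v)"
  define y where "y = (1/2) *\<^sub>R (u - v)"
  have xy: "x + y = u" "x - y = v"
    by (simp_all add: x_def y_def scaleR_add_right[symmetric] scaleR_diff_right[symmetric] scaleR_2[symmetric])
  have "(x, y) \<noteq> (0, 0)" using xy u by auto
  moreover have "x \<bottom>\<^sub>I y" using u v by (simp add: isosceles_orthogonal_def xy)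
  ultimately have "?f x y \<in> ?S" by blast
  then have "?f x y \<le> L_const TYPE('a) t"
    unfolding L_const_def by (rule cSup_upper[OF _ bdd])
  then show ?thesis unfolding isosceles_quotient unfolding xy using u by simp
qed

text \<open>At this value \<open>4 * L_const TYPE('a) t\<close> is
  \<open>2 * (1 + s\<^sup>2)\<close> for \<open>s = 1 - 2 * t\<close>, the rhombus bound, and
  \<open>t < 1/2\<close> makes \<open>s\<close> positive.\<close>

lemma hilbert_space_if_L_const:
  assumes t: "0 \<le> t" "t < 1/2" and L: "L_const TYPE('a::banach) t = 2 * t\<^sup>2 - 2 * t + 1"
  shows "hilbert_space TYPE('a)"
proof (rule quadratic_norm_imp_hilbert_space)
  fix x y :: 'a
  have s: "1 - 2 * t > 0" using t by simp
  have "(norm (u + (1 - 2 * t) *\<^sub>R v))\<^sup>2 + (norm (u - (1 - 2 * t) *\<^sub>R v))\<^sup>2 \<le> 2 * (1 + (1 - 2 * t)\<^sup>2)"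
    if "norm u = 1" "norm v = 1" for u v :: 'a
    using rhombus_le_L_const[of t u v] that t
    by (simp add: L power2_eq_square algebra_simps)
  from rhombus_imp_quadratic_norm[OF s this]
  show "\<exists>A B C. \<forall>a b. (norm (a *\<^sub>R x + b *\<^sub>R y))\<^sup>2 = A * a\<^sup>2 + 2 * B * a * b + C * b\<^sup>2"
    by metis
qed

theorem theorem8:
  assumes "dim_at_least TYPE('a::banach) 2"
  shows "(hilbert_space TYPE('a) \<longleftrightarrow>
            (\<forall>t\<in>{0..<1/2}. L_const TYPE('a) t = 2 * t\<^sup>2 - 2 * t + 1)) \<and>
         (hilbert_space TYPE('a) \<longleftrightarrow>
            (\<exists>t\<^sub>0\<in>{0..<1/2}. L_const TYPE('a) t\<^sub>0 = 2 * t\<^sub>0\<^sup>2 - 2 * t\<^sub>0 + 1))"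
proof -
  obtain B :: "'a set" where "independent B" "card B = 2"
    using assms by (auto simp: dim_at_least_def)
  then obtain x0 :: 'a where "x0 \<noteq> 0"
    by (metis card.empty dependent_zero ex_in_conv zero_neq_numeral)
  then have "L_const TYPE('a) t = 2 * t\<^sup>2 - 2 * t + 1" if "hilbert_space TYPE('a)" for t
    using L_const_hilbert that by blast
  moreover have "hilbert_space TYPE('a)"
    if "\<exists>t\<in>{0..<1/2}. L_const TYPE('a) t = 2 * t\<^sup>2 - 2 * t + 1"
    using that hilbert_space_if_L_const by auto
  \<comment> \<open>The value 0 leads from all \<open>t\<close> to some \<open>t\<close>.\<close>
  moreover have "(0::real) \<in> {0..<1/2}" by simp
  ultimately show ?thesis by blast
qed

end
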